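(* An $\mathsf{S4}^C_I$-algebra is embeddable into a complete $\mathsf{S4}^C_I$-algebra if and only if it is standard.
   Context: Fix a finite non-empty set $I$. An interior algebra is a Boolean algebra with a unary operation $\Box$ such that $\Box1=1$, $\Box(x\wedge y)=\Box x\wedge\Box y$, $\Box x=\Box\Box x$, $\Box x\le x$. An $\mathsf{S4}^C_I$-algebra is a Boolean algebra $A$ with unary operations $\Box_i$ ($i\in I$) and $\mathsf{C}$ such that each $\Box_i$ and $\mathsf{C}$ make $A$ an interior algebra, and $\mathsf{C}a\le\mathsf{E}a\wedge\mathsf{E}\mathsf{C}a$ and $\mathsf{E}a\wedge\mathsf{C}(a\to\mathsf{E}a)\le\mathsf{C}a$ for all $a\in A$, where $\mathsf{E}a:=\bigwedge_{i\in I}\Box_i a$. It is standard if, for every element $d$ and every sequence $(a_j)_{j\in\mathbb{N}}$ of elements with $a_j\le\mathsf{E}d\wedge\mathsf{E}a_{j+1}$ for all $j\in\mathbb{N}$, we have $a_0\le\mathsf{C}d$. It is complete if each of its subsets has a least upper bound. Embeddable means that there is an injective map preserving the Boolean operations, every $\Box_i$ ($i\in I$), and $\mathsf{C}$. *)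

theory Defs
  imports "HOL-Algebra.Complete_Lattice"
begin

text \<open>
  Algebras are carrier-based, so that algebras of different sizes can be compared and quantified
  over. The Boolean operations are those determined by the order: \<open>\<sqinter>\<close>, \<open>\<squnion>\<close>, \<open>\<bottom>\<close>, \<open>\<top>\<close> come from
  the lattice theory, and the complement is the unique one available in a Boolean lattice.
  The one-element algebra is allowed.
\<close>

locale boolean_lattice = bounded_lattice L for L (structure) +
  assumes meet_join_distrib:
    "\<lbrakk>x \<in> carrier L; y \<in> carrier L; z \<in> carrier L\<rbrakk>
      \<Longrightarrow> x \<sqinter> (y \<squnion> z) = (x \<sqinter> y) \<squnion> (x \<sqinter> z)"
  and compl_exists:
    "x \<in> carrier L \<Longrightarrow> \<exists>y \<in> carrier L. x \<sqinter> y = \<bottom> \<and> x \<squnion> y = \<top>"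

definition compl :: "('a, 'm) gorder_scheme \<Rightarrow> 'a \<Rightarrow> 'a" where
  "compl L x = (THE y. y \<in> carrier L \<and> x \<sqinter>\<^bsub>L\<^esub> y = \<bottom>\<^bsub>L\<^esub> \<and> x \<squnion>\<^bsub>L\<^esub> y = \<top>\<^bsub>L\<^esub>)"

definition boolean_imp :: "('a, 'm) gorder_scheme \<Rightarrow> 'a \<Rightarrow> 'a \<Rightarrow> 'a" where
  "boolean_imp L x y = compl L x \<squnion>\<^bsub>L\<^esub> y"

locale interior_algebra = boolean_lattice L for L (structure) +
  fixes f :: "'a \<Rightarrow> 'a"
  assumes int_closed: "x \<in> carrier L \<Longrightarrow> f x \<in> carrier L"
    and int_top: "f \<top> = \<top>"
    and int_meet: "\<lbrakk>x \<in> carrier L; y \<in> carrier L\<rbrakk> \<Longrightarrow> f (x \<sqinter> y) = f x \<sqinter> f y"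
    and int_idem: "x \<in> carrier L \<Longrightarrow> f x = f (f x)"
    and int_le: "x \<in> carrier L \<Longrightarrow> f x \<sqsubseteq> x"

record ('a, 'i) ck_structure = "'a gorder" +
  box :: "'i \<Rightarrow> 'a \<Rightarrow> 'a"
  com :: "'a \<Rightarrow> 'a"

definition everyone :: "'i set \<Rightarrow> ('a, 'i) ck_structure \<Rightarrow> 'a \<Rightarrow> 'a" where
  "everyone I A a = \<Sqinter>\<^bsub>A\<^esub> {box A i a |i. i \<in> I}"

definition S4C_algebra :: "'i set \<Rightarrow> ('a, 'i) ck_structure \<Rightarrow> bool" where
  "S4C_algebra I A \<longleftrightarrow>
     boolean_lattice A \<and>
     (\<forall>i\<in>I. interior_algebra A (box A i)) \<and>
     interior_algebra A (com A) \<and>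
     (\<forall>a\<in>carrier A. com A a \<sqsubseteq>\<^bsub>A\<^esub> everyone I A a \<sqinter>\<^bsub>A\<^esub> everyone I A (com A a)) \<and>
     (\<forall>a\<in>carrier A.
        everyone I A a \<sqinter>\<^bsub>A\<^esub> com A (boolean_imp A a (everyone I A a)) \<sqsubseteq>\<^bsub>A\<^esub> com A a)"

definition standard :: "'i set \<Rightarrow> ('a, 'i) ck_structure \<Rightarrow> bool" where
  "standard I A \<longleftrightarrow>
     (\<forall>d\<in>carrier A. \<forall>a :: nat \<Rightarrow> 'a.
        (\<forall>j. a j \<in> carrier A) \<and>
        (\<forall>j. a j \<sqsubseteq>\<^bsub>A\<^esub> everyone I A d \<sqinter>\<^bsub>A\<^esub> everyone I A (a (j + 1)))
        \<longrightarrow> a 0 \<sqsubseteq>\<^bsub>A\<^esub> com A d)"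

definition complete_algebra :: "('a, 'm) gorder_scheme \<Rightarrow> bool" where
  "complete_algebra L \<longleftrightarrow> (\<forall>S \<subseteq> carrier L. \<exists>s. is_lub L s S)"

definition embedding ::
  "'i set \<Rightarrow> ('a, 'i) ck_structure \<Rightarrow> ('b, 'i) ck_structure \<Rightarrow> ('a \<Rightarrow> 'b) \<Rightarrow> bool" where
  "embedding I A B h \<longleftrightarrow>
     h \<in> carrier A \<rightarrow> carrier B \<and>
     inj_on h (carrier A) \<and>
     h \<bottom>\<^bsub>A\<^esub> = \<bottom>\<^bsub>B\<^esub> \<and>
     h \<top>\<^bsub>A\<^esub> = \<top>\<^bsub>B\<^esub> \<and>
     (\<forall>x\<in>carrier A. \<forall>y\<in>carrier A. h (x \<sqinter>\<^bsub>A\<^esub> y) = h x \<sqinter>\<^bsub>B\<^esub> h y) \<and>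
     (\<forall>x\<in>carrier A. \<forall>y\<in>carrier A. h (x \<squnion>\<^bsub>A\<^esub> y) = h x \<squnion>\<^bsub>B\<^esub> h y) \<and>
     (\<forall>x\<in>carrier A. h (compl A x) = compl B (h x)) \<and>
     (\<forall>i\<in>I. \<forall>x\<in>carrier A. h (box A i x) = box B i (h x)) \<and>
     (\<forall>x\<in>carrier A. h (com A x) = com B (h x))"

text \<open>
  HOL cannot quantify existentially over types, so the type over which the target algebra
  is built is a parameter of embeddability.
\<close>

definition embeddable_into_complete ::
  "'b itself \<Rightarrow> 'i set \<Rightarrow> ('a, 'i) ck_structure \<Rightarrow> bool" where
  "embeddable_into_complete T I A \<longleftrightarrow>
     (\<exists>B :: ('b, 'i) ck_structure. S4C_algebra I B \<and> complete_algebra B \<and> (\<exists>h. embedding I A B h))"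

end

theory Submission
  imports Defs
begin

text \<open>
  Write a post-fixpoint for \<open>d\<close> for an element \<open>x\<close> with \<open>x \<le> E d \<and> E x\<close>. By the
  induction axiom every post-fixpoint for \<open>d\<close> lies below \<open>C d\<close>
  (\<open>S4C_induction\<close>). Standardness extends this from one element to infinite chains
  \<open>a\<^sub>0, a\<^sub>1, \<dots>\<close> in which each \<open>a\<^sub>j\<close> lies below \<open>E d \<and> E a\<^sub>j\<^sub>+\<^sub>1\<close>.

  In a complete algebra the join of such a chain is a post-fixpoint, because the boxes are
  monotone; hence complete algebras are standard. Standardness is a Horn condition with infinitely
  many premises in the operations of the algebra, so an embedding reflects it. This is the direction
  from embeddability to standardness.

  Conversely, let \<open>A\<close> be standard and let \<open>X\<close> be the set of its prime filters. The Stone map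
  sends \<open>a\<close> to the set of prime filters containing \<open>a\<close> and embeds the Boolean algebra \<open>A\<close> into the
  power set of \<open>X\<close>. The usual relational box on \<open>X\<close> would not do: there \<open>C\<close> need not become the
  greatest fixpoint. Instead, as in the McKinsey-Tarski representation of interior algebras,
  \<open>\<box>\<^sub>i\<close> is extended to all sets as the interior operator of the topology with basis
  \<open>{stone (\<box>\<^sub>i b) | b \<in> A}\<close> (\<open>stone_int\<close>), and \<open>C U\<close> is the union of all sets
  \<open>Y \<subseteq> E U \<inter> E Y\<close>. Any finite nonempty family of interior operators on a power set gives a
  complete algebra in this way (\<open>powerset_algebra_S4C\<close>).

  That the Stone map preserves the boxes is immediate, and it sends \<open>C d\<close> to a post-fixpoint,
  so \<open>stone (C d) \<subseteq> C (stone d)\<close>. For the other inclusion take a post-fixpoint \<open>Y\<close> for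
  \<open>stone d\<close>. Each prime filter in \<open>Y\<close> lies in a set \<open>stone a\<^sub>0 \<subseteq> Y\<close>. If \<open>stone a\<^sub>j \<subseteq> Y\<close>,
  then \<open>stone a\<^sub>j\<close> is covered by the sets \<open>stone (\<box>\<^sub>i b)\<close> with \<open>stone b \<subseteq> Y\<close>; by compactness and
  monotonicity a single \<open>b\<close> suffices (\<open>stone_subset_stone_intE\<close>), and since \<open>I\<close> is finite it can
  be chosen the same for all \<open>i\<close>. This \<open>b\<close> is \<open>a\<^sub>j\<^sub>+\<^sub>1\<close>. Standardness of \<open>A\<close> applies to the resulting
  chain and gives \<open>a\<^sub>0 \<le> C d\<close>, so \<open>Y \<subseteq> stone (C d)\<close> (\<open>standard_postfixpoint_subset\<close>).
\<close>

section \<open>Complements, implication and the operator E\<close>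

context boolean_lattice
begin

lemma le_meet_iff:
  assumes "x \<in> carrier L" "y \<in> carrier L" "z \<in> carrier L"
  shows "z \<sqsubseteq> x \<sqinter> y \<longleftrightarrow> z \<sqsubseteq> x \<and> z \<sqsubseteq> y"
  using assms by (meson le_trans meet_closed meet_le meet_left meet_right)

lemma meet_mono:
  assumes "w \<in> carrier L" "x \<in> carrier L" "y \<in> carrier L" "z \<in> carrier L"
    and "w \<sqsubseteq> y" "x \<sqsubseteq> z"
  shows "w \<sqinter> x \<sqsubseteq> y \<sqinter> z"
  using assms le_trans[of "w \<sqinter> x" w y] le_trans[of "w \<sqinter> x" x z]
  by (simp add: le_meet_iff meet_left meet_right)

lemma complement_le:
  assumes car: "x \<in> carrier L" "y \<in> carrier L" "z \<in> carrier L"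
    and "x \<sqinter> y = \<bottom>" "x \<squnion> z = \<top>"
  shows "y \<sqsubseteq> z"
proof -
  have "y = y \<sqinter> (x \<squnion> z)"
    using assms le_iff_join[of y \<top>] by simp
  also have "\<dots> = (y \<sqinter> x) \<squnion> (y \<sqinter> z)"
    using car by (simp add: meet_join_distrib)
  also have "\<dots> \<sqsubseteq> z"
    using assms by (intro join_le) (auto simp: meet_comm[of L y x] meet_right)
  finally show ?thesis .
qed

lemma compl_eqI:
  assumes "x \<in> carrier L" "y \<in> carrier L" "x \<sqinter> y = \<bottom>" "x \<squnion> y = \<top>"
  shows "compl L x = y"
  unfolding compl_def
proof (rule the_equality)
  fix z assume "z \<in> carrier L \<and> x \<sqinter> z = \<bottom> \<and> x \<squnion> z = \<top>"
  with assms show "z = y"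
    using complement_le[of x y z] complement_le[of x z y] le_antisym by simp
qed (use assms in simp)

lemma compl_props:
  assumes "x \<in> carrier L"
  shows compl_closed: "compl L x \<in> carrier L"
    and meet_compl: "x \<sqinter> compl L x = \<bottom>"
    and join_compl: "x \<squnion> compl L x = \<top>"
  using compl_exists[OF assms] compl_eqI[OF assms] by auto

lemma boolean_imp_eq_top:
  assumes "x \<in> carrier L" "y \<in> carrier L" "x \<sqsubseteq> y"
  shows "boolean_imp L x y = \<top>"
proof -
  have c: "compl L x \<in> carrier L" by (rule compl_closed[OF assms(1)])
  have "x \<squnion> compl L x \<sqsubseteq> compl L x \<squnion> y"
    using assms c by (meson join_closed join_le join_left join_right le_trans)
  then show ?thesis
    unfolding boolean_imp_def using assms c join_compl[OF assms(1)]
    by (metis join_closed le_antisym top_closed top_higher)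
qed

lemma modus_ponens:
  assumes "x \<in> carrier L" "y \<in> carrier L"
  shows "x \<sqinter> boolean_imp L x y \<sqsubseteq> y"
proof -
  have c: "compl L x \<in> carrier L" by (rule compl_closed[OF assms(1)])
  have "x \<sqinter> boolean_imp L x y = \<bottom> \<squnion> (x \<sqinter> y)"
    unfolding boolean_imp_def using assms c by (simp add: meet_join_distrib meet_compl)
  also have "\<dots> \<sqsubseteq> y"
    using assms by (intro join_le) (auto simp: meet_right)
  finally show ?thesis .
qed

end

lemma (in interior_algebra) int_mono:
  assumes "x \<in> carrier L" "y \<in> carrier L" "x \<sqsubseteq> y"
  shows "f x \<sqsubseteq> f y"
proof -
  have "f x = f x \<sqinter> f y"
    using assms le_iff_join[of x y] int_meet[of x y] by simp
  then show ?thesis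
    using assms int_closed by (metis meet_right)
qed

lemma everyone_greatest:
  assumes "boolean_lattice A" "finite I" "I \<noteq> {}" "\<And>i. i \<in> I \<Longrightarrow> box A i a \<in> carrier A"
  shows everyone_closed: "everyone I A a \<in> carrier A"
    and "x \<in> carrier A \<Longrightarrow> x \<sqsubseteq>\<^bsub>A\<^esub> everyone I A a \<longleftrightarrow> (\<forall>i\<in>I. x \<sqsubseteq>\<^bsub>A\<^esub> box A i a)"
proof -
  interpret boolean_lattice A by fact
  have eq: "{box A i a |i. i \<in> I} = (\<lambda>i. box A i a) ` I" by auto
  have g: "greatest A (everyone I A a) (Lower A ((\<lambda>i. box A i a) ` I))"
    unfolding everyone_def eq using assms by (intro finite_inf_greatest) auto
  then show cl: "everyone I A a \<in> carrier A" by auto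
  show "x \<sqsubseteq>\<^bsub>A\<^esub> everyone I A a \<longleftrightarrow> (\<forall>i\<in>I. x \<sqsubseteq>\<^bsub>A\<^esub> box A i a)" if x: "x \<in> carrier A"
  proof
    assume le: "x \<sqsubseteq>\<^bsub>A\<^esub> everyone I A a"
    show "\<forall>i\<in>I. x \<sqsubseteq>\<^bsub>A\<^esub> box A i a"
    proof
      fix i assume i: "i \<in> I"
      have "everyone I A a \<sqsubseteq>\<^bsub>A\<^esub> box A i a"
        using i assms(4) by (intro greatest_Lower_below[OF g]) auto
      then show "x \<sqsubseteq>\<^bsub>A\<^esub> box A i a" by (rule le_trans[OF le _ x cl assms(4)[OF i]])
    qed
  next
    assume "\<forall>i\<in>I. x \<sqsubseteq>\<^bsub>A\<^esub> box A i a"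
    then have "x \<in> Lower A ((\<lambda>i. box A i a) ` I)"
      using x by (auto simp: Lower_def)
    then show "x \<sqsubseteq>\<^bsub>A\<^esub> everyone I A a" using g by (simp add: greatest_def)
  qed
qed

lemma S4C_box_closed:
  "S4C_algebra I A \<Longrightarrow> i \<in> I \<Longrightarrow> a \<in> carrier A \<Longrightarrow> box A i a \<in> carrier A"
  by (simp add: S4C_algebra_def interior_algebra.int_closed)

lemma S4C_le_everyone_meet_iff:
  assumes "S4C_algebra I A" "finite I" "I \<noteq> {}"
    and car: "x \<in> carrier A" "d \<in> carrier A" "y \<in> carrier A"
  shows "x \<sqsubseteq>\<^bsub>A\<^esub> everyone I A d \<sqinter>\<^bsub>A\<^esub> everyone I A y \<longleftrightarrow>
     (\<forall>i\<in>I. x \<sqsubseteq>\<^bsub>A\<^esub> box A i d \<and> x \<sqsubseteq>\<^bsub>A\<^esub> box A i y)"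
proof -
  interpret boolean_lattice A using assms(1) by (simp add: S4C_algebra_def)
  note E = everyone_greatest[OF boolean_lattice_axioms assms(2,3) S4C_box_closed[OF assms(1)]]
  show ?thesis using car by (auto simp: le_meet_iff E)
qed

section \<open>Standardness of complete algebras and of their subalgebras\<close>

text \<open>
  If \<open>x \<le> E x\<close>, then \<open>x \<rightarrow> E x\<close> is the top element, and so is its image under \<open>C\<close>; the induction
  axiom collapses to \<open>E x \<le> C x\<close>. The other half \<open>x \<le> E d \<le> d\<close> turns \<open>x \<le> C x\<close> into
  \<open>x \<le> C d\<close> by monotonicity.
\<close>
lemma S4C_induction:
  assumes A: "S4C_algebra I A" "finite I" "I \<noteq> {}"
    and car: "x \<in> carrier A" "d \<in> carrier A"
    and x: "x \<sqsubseteq>\<^bsub>A\<^esub> everyone I A d \<sqinter>\<^bsub>A\<^esub> everyone I A x"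
  shows "x \<sqsubseteq>\<^bsub>A\<^esub> com A d"
proof -
  interpret interior_algebra A "com A" using A by (simp add: S4C_algebra_def)
  note E = everyone_greatest[OF boolean_lattice_axioms assms(2,3) S4C_box_closed[OF assms(1)]]
  have Ex: "everyone I A x \<in> carrier A" and xEx: "x \<sqsubseteq>\<^bsub>A\<^esub> everyone I A x"
    using x car by (simp_all add: E le_meet_iff)
  have "everyone I A x \<sqinter>\<^bsub>A\<^esub> com A (boolean_imp A x (everyone I A x)) \<sqsubseteq>\<^bsub>A\<^esub> com A x"
    using A car by (simp add: S4C_algebra_def)
  then have "everyone I A x \<sqinter>\<^bsub>A\<^esub> \<top>\<^bsub>A\<^esub> \<sqsubseteq>\<^bsub>A\<^esub> com A x"
    using boolean_imp_eq_top[OF car(1) Ex xEx] by (simp add: int_top)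
  moreover have "everyone I A x \<sqinter>\<^bsub>A\<^esub> \<top>\<^bsub>A\<^esub> = everyone I A x"
    using Ex le_iff_join[of "everyone I A x" "\<top>\<^bsub>A\<^esub>"] by simp
  ultimately have 1: "x \<sqsubseteq>\<^bsub>A\<^esub> com A x"
    using xEx Ex car int_closed le_trans by metis
  obtain i where i: "i \<in> I" using A(3) by blast
  have "x \<sqsubseteq>\<^bsub>A\<^esub> box A i d"
    using x i by (simp add: S4C_le_everyone_meet_iff[OF A car(1,2,1)])
  moreover have "box A i d \<sqsubseteq>\<^bsub>A\<^esub> d"
    using A i car by (simp add: S4C_algebra_def interior_algebra.int_le)
  ultimately have "x \<sqsubseteq>\<^bsub>A\<^esub> d"
    by (rule le_trans[OF _ _ car(1) S4C_box_closed[OF A(1) i car(2)] car(2)])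
  then have "com A x \<sqsubseteq>\<^bsub>A\<^esub> com A d" by (rule int_mono[OF car])
  with 1 show ?thesis
    by (rule le_trans[OF _ _ car(1) int_closed[OF car(1)] int_closed[OF car(2)]])
qed

text \<open>
  The join \<open>s\<close> of the sequence satisfies \<open>s \<le> E d \<and> E s\<close>: each \<open>a j\<close> is below both
  \<open>\<box>\<^sub>i d\<close> and \<open>\<box>\<^sub>i (a (j + 1)) \<le> \<box>\<^sub>i s\<close>, so these are upper bounds of the sequence.
\<close>
lemma complete_imp_standard:
  fixes A :: "('a, 'i) ck_structure"
  assumes A: "S4C_algebra I A" "finite I" "I \<noteq> {}" and "complete_algebra A"
  shows "standard I A"
  unfolding standard_def
proof (intro ballI allI impI, elim conjE)
  fix d and a :: "nat \<Rightarrow> 'a"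
  assume d: "d \<in> carrier A" and a: "\<forall>j. a j \<in> carrier A"
    and step: "\<forall>j. a j \<sqsubseteq>\<^bsub>A\<^esub> everyone I A d \<sqinter>\<^bsub>A\<^esub> everyone I A (a (j + 1))"
  interpret boolean_lattice A using A by (simp add: S4C_algebra_def)
  have ran: "range a \<subseteq> carrier A" using a by auto
  with assms(4) obtain s where s: "is_lub A s (range a)"
    unfolding complete_algebra_def by blast
  have sc: "s \<in> carrier A" using s by auto
  have le_s: "a j \<sqsubseteq>\<^bsub>A\<^esub> s" for j
    using least_Upper_above[OF s _ ran] by auto
  have "a j \<sqsubseteq>\<^bsub>A\<^esub> box A i d \<and> a j \<sqsubseteq>\<^bsub>A\<^esub> box A i s" if i: "i \<in> I" for i j
  proof -
    interpret interior_algebra A "box A i" using A i by (simp add: S4C_algebra_def)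
    have "a j \<sqsubseteq>\<^bsub>A\<^esub> box A i d \<and> a j \<sqsubseteq>\<^bsub>A\<^esub> box A i (a (j + 1))"
      using step a i by (simp add: S4C_le_everyone_meet_iff[OF A _ d])
    moreover have "box A i (a (j + 1)) \<sqsubseteq>\<^bsub>A\<^esub> box A i s"
      using a by (intro int_mono sc le_s) simp
    ultimately show ?thesis using le_trans[of "a j" "box A i (a (j + 1))" "box A i s"] a sc int_closed
      by simp
  qed
  then have "box A i d \<in> Upper A (range a)" "box A i s \<in> Upper A (range a)" if "i \<in> I" for i
    using that S4C_box_closed[OF A(1)] d sc by (auto simp: Upper_def)
  then have "s \<sqsubseteq>\<^bsub>A\<^esub> everyone I A d \<sqinter>\<^bsub>A\<^esub> everyone I A s"
    using least_le[OF s] by (simp add: S4C_le_everyone_meet_iff[OF A sc d sc])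
  then have "s \<sqsubseteq>\<^bsub>A\<^esub> com A d" by (rule S4C_induction[OF A sc d])
  moreover have "com A d \<in> carrier A"
    using A d by (simp add: S4C_algebra_def interior_algebra.int_closed)
  ultimately show "a 0 \<sqsubseteq>\<^bsub>A\<^esub> com A d"
    using le_s[of 0] le_trans[of "a 0" s "com A d"] a sc by simp
qed

lemma embedding_le_iff:
  assumes "boolean_lattice A" "boolean_lattice B" "embedding I A B h"
    and "x \<in> carrier A" "y \<in> carrier A"
  shows "h x \<sqsubseteq>\<^bsub>B\<^esub> h y \<longleftrightarrow> x \<sqsubseteq>\<^bsub>A\<^esub> y"
proof -
  interpret A: boolean_lattice A by fact
  interpret B: boolean_lattice B by fact
  have h: "h x \<in> carrier B" "h y \<in> carrier B" "h (x \<sqinter>\<^bsub>A\<^esub> y) = h x \<sqinter>\<^bsub>B\<^esub> h y"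
    and inj: "inj_on h (carrier A)"
    using assms by (auto simp: embedding_def)
  have "h x \<sqsubseteq>\<^bsub>B\<^esub> h y \<longleftrightarrow> h x = h (x \<sqinter>\<^bsub>A\<^esub> y)"
    using h by (simp add: B.le_iff_join)
  also have "\<dots> \<longleftrightarrow> x = x \<sqinter>\<^bsub>A\<^esub> y"
    using inj assms(4,5) by (simp add: inj_on_eq_iff)
  finally show ?thesis using assms by (simp add: A.le_iff_join)
qed

text \<open>
  The image of a sequence that tests standardness of \<open>A\<close> tests standardness of \<open>B\<close>. The meet
  \<open>E\<close> never has to be transported: below it means below each box.
\<close>
lemma embedding_reflects_standard:
  fixes A :: "('a, 'i) ck_structure" and B :: "('b, 'i) ck_structure"
  assumes A: "S4C_algebra I A" and B: "S4C_algebra I B" and I: "finite I" "I \<noteq> {}"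
    and h: "embedding I A B h" and "standard I B"
  shows "standard I A"
  unfolding standard_def
proof (intro ballI allI impI, elim conjE)
  fix d and a :: "nat \<Rightarrow> 'a"
  assume d: "d \<in> carrier A" and a: "\<forall>j. a j \<in> carrier A"
    and step: "\<forall>j. a j \<sqsubseteq>\<^bsub>A\<^esub> everyone I A d \<sqinter>\<^bsub>A\<^esub> everyone I A (a (j + 1))"
  have "boolean_lattice A" "boolean_lattice B"
    using A B by (simp_all add: S4C_algebra_def)
  note le = embedding_le_iff[OF this h]
  have hc: "h x \<in> carrier B" if "x \<in> carrier A" for x
    using h that by (auto simp: embedding_def)
  have hbox: "h (box A i x) = box B i (h x)" if "i \<in> I" "x \<in> carrier A" for i x
    using h that by (auto simp: embedding_def)
  have "h (a j) \<sqsubseteq>\<^bsub>B\<^esub> everyone I B (h d) \<sqinter>\<^bsub>B\<^esub> everyone I B (h (a (j + 1)))" for j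
    using step a d S4C_le_everyone_meet_iff[OF A I]
    by (simp add: S4C_le_everyone_meet_iff[OF B I] hc le S4C_box_closed[OF A] flip: hbox)
  then have "h (a 0) \<sqsubseteq>\<^bsub>B\<^esub> com B (h d)"
    using \<open>standard I B\<close>[unfolded standard_def, rule_format, of "h d" "\<lambda>j. h (a j)"] a d hc
    by simp
  moreover have "com B (h d) = h (com A d)" "com A d \<in> carrier A"
    using h A d by (auto simp: embedding_def S4C_algebra_def interior_algebra.int_closed)
  ultimately show "a 0 \<sqsubseteq>\<^bsub>A\<^esub> com A d"
    using le a by simp
qed

lemma embeddable_into_complete_imp_standard:
  assumes "S4C_algebra I A" "finite I" "I \<noteq> {}" "embeddable_into_complete TYPE('b) I A"
  shows "standard I A"
  using assms complete_imp_standard embedding_reflects_standard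
  unfolding embeddable_into_complete_def by metis

section \<open>Power sets with several interior operators\<close>

locale interior_frame =
  fixes X :: "'p set" and I :: "'i set" and bx :: "'i \<Rightarrow> 'p set \<Rightarrow> 'p set"
  assumes finite_index: "finite I" and index_nonempty: "I \<noteq> {}"
    and int_subset: "\<lbrakk>i \<in> I; U \<subseteq> X\<rbrakk> \<Longrightarrow> bx i U \<subseteq> U"
    and int_space: "i \<in> I \<Longrightarrow> bx i X = X"
    and int_Int: "\<lbrakk>i \<in> I; U \<subseteq> X; V \<subseteq> X\<rbrakk> \<Longrightarrow> bx i (U \<inter> V) = bx i U \<inter> bx i V"
    and int_int: "\<lbrakk>i \<in> I; U \<subseteq> X\<rbrakk> \<Longrightarrow> bx i (bx i U) = bx i U"
begin

text \<open>
  The greatest fixpoint of \<open>Y \<mapsto> E U \<inter> E Y\<close>, in the Knaster-Tarski form. The operator \<open>E\<close> is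
  unfolded into the single boxes, so that the definition can precede the algebra in which \<open>E\<close> is
  computed.
\<close>
definition common :: "'p set \<Rightarrow> 'p set" where
  "common U = \<Union>{Y. Y \<subseteq> X \<and> (\<forall>i\<in>I. Y \<subseteq> bx i U \<and> Y \<subseteq> bx i Y)}"

definition powerset_algebra :: "('p set, 'i) ck_structure" where
  "powerset_algebra =
     \<lparr>carrier = Pow X, eq = (=), le = (\<subseteq>), box = bx, com = common\<rparr>"

abbreviation P where "P \<equiv> powerset_algebra"

lemma P_simps [simp]:
  "carrier P = Pow X" "eq P = (=)" "le P = (\<subseteq>)" "box P = bx" "com P = common"
  by (simp_all add: powerset_algebra_def)

lemma int_mono: "\<lbrakk>i \<in> I; V \<subseteq> X; U \<subseteq> V\<rbrakk> \<Longrightarrow> bx i U \<subseteq> bx i V"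
  using int_Int[of i U V] by (simp add: Int_absorb2 Int_absorb1 subset_trans) blast

lemma P_partial_order: "partial_order P"
  by unfold_locales auto

lemma P_is_lub: "\<S> \<subseteq> Pow X \<Longrightarrow> is_lub P (\<Union>\<S>) \<S>"
  unfolding least_def Upper_def by simp blast

lemma P_is_glb: "\<S> \<subseteq> Pow X \<Longrightarrow> is_glb P (X \<inter> \<Inter>\<S>) \<S>"
  unfolding greatest_def Lower_def by simp blast

lemma P_complete_lattice: "complete_lattice P"
proof -
  interpret partial_order P by (rule P_partial_order)
  show ?thesis
    by unfold_locales (auto intro: P_is_lub P_is_glb)
qed

lemma P_inf: "\<S> \<subseteq> Pow X \<Longrightarrow> \<Sqinter>\<^bsub>P\<^esub>\<S> = X \<inter> \<Inter>\<S>"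
  unfolding inf_def
  by (rule some_equality)
    (erule P_is_glb, rule partial_order.greatest_unique[OF P_partial_order _ P_is_glb])

lemma P_sup: "\<S> \<subseteq> Pow X \<Longrightarrow> \<Squnion>\<^bsub>P\<^esub>\<S> = \<Union>\<S>"
  unfolding sup_def
  by (rule some_equality)
    (erule P_is_lub, rule partial_order.least_unique[OF P_partial_order _ P_is_lub])

lemma P_meet [simp]: "\<lbrakk>U \<subseteq> X; V \<subseteq> X\<rbrakk> \<Longrightarrow> U \<sqinter>\<^bsub>P\<^esub> V = U \<inter> V"
  unfolding meet_def by (subst P_inf) auto

lemma P_join [simp]: "\<lbrakk>U \<subseteq> X; V \<subseteq> X\<rbrakk> \<Longrightarrow> U \<squnion>\<^bsub>P\<^esub> V = U \<union> V"
  unfolding join_def by (subst P_sup) auto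

lemma P_top [simp]: "\<top>\<^bsub>P\<^esub> = X"
proof -
  interpret complete_lattice P by (rule P_complete_lattice)
  have "\<top>\<^bsub>P\<^esub> \<subseteq> X" "X \<subseteq> \<top>\<^bsub>P\<^esub>" using top_closed top_higher[of X] by simp_all
  then show ?thesis by (rule subset_antisym)
qed

lemma P_bottom [simp]: "\<bottom>\<^bsub>P\<^esub> = {}"
proof -
  interpret complete_lattice P by (rule P_complete_lattice)
  have "\<bottom>\<^bsub>P\<^esub> \<subseteq> {}" using bottom_lower[of "{}"] by simp
  then show ?thesis by simp
qed

lemma P_boolean_lattice: "boolean_lattice P"
proof -
  interpret complete_lattice P by (rule P_complete_lattice)
  show ?thesis
  proof (unfold_locales, goal_cases)
    case (1 U V W)
    then have "U \<subseteq> X" "V \<subseteq> X" "W \<subseteq> X" by simp_all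
    then show ?case by (simp add: le_infI1 Int_Un_distrib)
  next
    case (2 U)
    then have "U \<subseteq> X" "X - U \<subseteq> X" by auto
    then show ?case by (intro bexI[of _ "X - U"]) (simp_all add: Un_absorb1)
  qed
qed

lemma P_compl: "U \<subseteq> X \<Longrightarrow> compl P U = X - U"
  by (rule boolean_lattice.compl_eqI[OF P_boolean_lattice]) auto

lemma int_closed: "\<lbrakk>i \<in> I; U \<subseteq> X\<rbrakk> \<Longrightarrow> bx i U \<subseteq> X"
  using int_subset by blast

lemma P_everyone: "U \<subseteq> X \<Longrightarrow> everyone I P U = (\<Inter>i\<in>I. bx i U)"
proof -
  assume U: "U \<subseteq> X"
  have "{bx i U |i. i \<in> I} \<subseteq> Pow X" using int_closed U by auto
  then have "everyone I P U = X \<inter> \<Inter>{bx i U |i. i \<in> I}"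
    by (simp add: everyone_def P_inf)
  also have "\<dots> = (\<Inter>i\<in>I. bx i U)"
    using index_nonempty int_closed U by blast
  finally show ?thesis .
qed

lemma common_greatest:
  "\<lbrakk>Y \<subseteq> X; \<And>i. i \<in> I \<Longrightarrow> Y \<subseteq> bx i U; \<And>i. i \<in> I \<Longrightarrow> Y \<subseteq> bx i Y\<rbrakk> \<Longrightarrow> Y \<subseteq> common U"
  unfolding common_def by (rule Union_upper) simp

lemma common_closed: "common U \<subseteq> X"
  unfolding common_def by (rule Union_least) simp

lemma common_le_int: "i \<in> I \<Longrightarrow> common U \<subseteq> bx i U"
  unfolding common_def by (rule Union_least) simp

lemma common_le_int_common: "i \<in> I \<Longrightarrow> common U \<subseteq> bx i (common U)"
proof
  fix u assume i: "i \<in> I" and "u \<in> common U"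
  then obtain Y where Y: "u \<in> Y" "Y \<subseteq> X" "\<forall>i\<in>I. Y \<subseteq> bx i U \<and> Y \<subseteq> bx i Y"
    unfolding common_def by blast
  then have "Y \<subseteq> common U" by (intro common_greatest) auto
  then have "bx i Y \<subseteq> bx i (common U)" by (rule int_mono[OF i common_closed])
  with Y i show "u \<in> bx i (common U)" by blast
qed

lemma common_subset: "U \<subseteq> X \<Longrightarrow> common U \<subseteq> U"
proof -
  assume "U \<subseteq> X"
  moreover obtain i where "i \<in> I" using index_nonempty by blast
  ultimately show ?thesis using common_le_int[of i U] int_subset[of i U] by simp
qed

lemma common_mono: "\<lbrakk>V \<subseteq> X; U \<subseteq> V\<rbrakk> \<Longrightarrow> common U \<subseteq> common V"
  by (rule common_greatest[OF common_closed])
    (simp_all add: common_le_int_common subset_trans[OF common_le_int int_mono])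

lemma common_interior: "interior_algebra P common"
proof -
  interpret boolean_lattice P by (rule P_boolean_lattice)
  show ?thesis
  proof (unfold_locales, goal_cases)
    case 1
    then show ?case using common_closed by simp
  next
    case 2
    have "X \<subseteq> common X" using int_space by (intro common_greatest) auto
    then show ?case using common_closed by auto
  next
    case (3 U V)
    then have UV: "U \<subseteq> X" "V \<subseteq> X" by auto
    have "common U \<inter> common V \<subseteq> common (U \<inter> V)"
    proof (rule common_greatest)
      fix i assume i: "i \<in> I"
      show "common U \<inter> common V \<subseteq> bx i (U \<inter> V)"
        using common_le_int[OF i] int_Int[OF i UV] by blast
      show "common U \<inter> common V \<subseteq> bx i (common U \<inter> common V)"
        using common_le_int_common[OF i] int_Int[OF i common_closed common_closed] by blast
    qed (use common_closed in blast)
    moreover have "common (U \<inter> V) \<subseteq> common U" "common (U \<inter> V) \<subseteq> common V"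
      using UV by (simp_all add: common_mono)
    ultimately have "common (U \<inter> V) = common U \<inter> common V" by blast
    with UV show ?case by (simp add: common_closed)
  next
    case (4 U)
    have "common U \<subseteq> common (common U)"
      by (intro common_greatest common_closed common_le_int_common)
    then show ?case using common_subset[OF common_closed] by blast
  next
    case (5 U)
    then show ?case using common_subset by simp
  qed
qed

lemma int_interior: "i \<in> I \<Longrightarrow> interior_algebra P (bx i)"
proof -
  assume i: "i \<in> I"
  interpret boolean_lattice P by (rule P_boolean_lattice)
  show ?thesis
    by unfold_locales
      (use i int_closed int_space int_Int int_int int_subset in auto)
qed

text \<open>
  For the induction axiom, let \<open>V\<close> be \<open>U \<rightarrow> E U\<close> and \<open>Z = E U \<inter> C V\<close>. Then
  \<open>Z \<subseteq> E U\<close>, and \<open>Z \<subseteq> E Z\<close>: each \<open>\<box>\<^sub>i\<close> of \<open>U \<inter> V\<close> is inside \<open>\<box>\<^sub>i (E U)\<close> by modus ponens,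
  while \<open>C V\<close> is contained in its own box. Hence \<open>Z \<subseteq> C U\<close>, since \<open>C U\<close> is the greatest
  such set.
\<close>
theorem powerset_algebra_S4C: "S4C_algebra I P"
proof -
  interpret boolean_lattice P by (rule P_boolean_lattice)
  have E_closed: "everyone I P U \<subseteq> X" if U: "U \<subseteq> X" for U
  proof -
    obtain i where "i \<in> I" using index_nonempty by blast
    with int_closed[OF this U] show ?thesis by (auto simp: P_everyone U)
  qed
  have 1: "common U \<subseteq> everyone I P U \<inter> everyone I P (common U)" if "U \<subseteq> X" for U
    using that by (simp add: P_everyone common_closed INF_greatest common_le_int common_le_int_common)
  have 2: "everyone I P U \<inter> common (boolean_imp P U (everyone I P U)) \<subseteq> common U"
    (is "?E \<inter> common ?V \<subseteq> _") if U: "U \<subseteq> X" for U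
  proof (rule common_greatest)
    have V: "?V \<subseteq> X" using U E_closed by (simp add: boolean_imp_def P_compl Diff_subset)
    show "?E \<inter> common ?V \<subseteq> X" using common_closed by blast
    fix i assume i: "i \<in> I"
    show "?E \<inter> common ?V \<subseteq> bx i U" using i U by (auto simp: P_everyone)
    have "bx i U \<inter> bx i ?V \<subseteq> bx i ?E"
    proof -
      have "U \<inter> ?V \<subseteq> ?E" using modus_ponens[of U ?E] U V E_closed[OF U] by simp
      then have "bx i (U \<inter> ?V) \<subseteq> bx i ?E" by (rule int_mono[OF i E_closed[OF U]])
      then show ?thesis using int_Int[OF i U V] by simp
    qed
    moreover have "?E \<subseteq> bx i U" using i U by (auto simp: P_everyone)
    moreover have "common ?V \<subseteq> bx i ?V" "common ?V \<subseteq> bx i (common ?V)"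
      by (rule common_le_int[OF i], rule common_le_int_common[OF i])
    ultimately show "?E \<inter> common ?V \<subseteq> bx i (?E \<inter> common ?V)"
      using int_Int[OF i E_closed[OF U] common_closed] by blast
  qed
  show ?thesis
    unfolding S4C_algebra_def
    using P_boolean_lattice common_interior int_interior 1 2 E_closed common_closed by simp
qed

lemma powerset_algebra_complete: "complete_algebra P"
  unfolding complete_algebra_def using P_is_lub by auto

end

section \<open>Prime filters and the Stone map\<close>

context boolean_lattice
begin

definition lattice_filter :: "'a set \<Rightarrow> bool" where
  "lattice_filter F \<longleftrightarrow> F \<subseteq> carrier L \<and> \<top> \<in> F \<and> (\<forall>x\<in>F. \<forall>y\<in>F. x \<sqinter> y \<in> F) \<and>
     (\<forall>x\<in>F. \<forall>y\<in>carrier L. x \<sqsubseteq> y \<longrightarrow> y \<in> F)"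

definition prime_filters :: "'a set set" where
  "prime_filters = {F. lattice_filter F \<and> \<bottom> \<notin> F \<and>
     (\<forall>x\<in>carrier L. \<forall>y\<in>carrier L. x \<squnion> y \<in> F \<longrightarrow> x \<in> F \<or> y \<in> F)}"

lemma filter_adjoin:
  assumes F: "lattice_filter F" and x: "x \<in> carrier L"
  defines "G \<equiv> {z \<in> carrier L. \<exists>m\<in>F. m \<sqinter> x \<sqsubseteq> z}"
  shows "lattice_filter G" "F \<subseteq> G" "x \<in> G"
proof -
  have Fc: "m \<in> carrier L" if "m \<in> F" for m using F that by (auto simp: lattice_filter_def)
  have top: "\<top> \<in> F" using F by (simp add: lattice_filter_def)
  show "F \<subseteq> G" unfolding G_def using Fc x meet_left by blast
  show "x \<in> G" unfolding G_def using Fc x top meet_right by blast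
  show "lattice_filter G"
    unfolding lattice_filter_def
  proof (intro conjI ballI impI)
    show "G \<subseteq> carrier L" "\<top> \<in> G"
      using top \<open>F \<subseteq> G\<close> by (auto simp: G_def)
  next
    fix y z assume "y \<in> G" "z \<in> G"
    then obtain m n where mn: "y \<in> carrier L" "z \<in> carrier L" "m \<in> F" "n \<in> F"
      "m \<sqinter> x \<sqsubseteq> y" "n \<sqinter> x \<sqsubseteq> z" by (auto simp: G_def)
    have "m \<sqinter> n \<in> F" using F mn by (simp add: lattice_filter_def)
    moreover have "(m \<sqinter> n) \<sqinter> x \<sqsubseteq> m \<sqinter> x" "(m \<sqinter> n) \<sqinter> x \<sqsubseteq> n \<sqinter> x"
      using mn Fc x by (simp_all add: meet_mono meet_left meet_right)
    then have "(m \<sqinter> n) \<sqinter> x \<sqsubseteq> y \<sqinter> z"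
      using mn Fc x le_trans[of "(m \<sqinter> n) \<sqinter> x" "m \<sqinter> x" y]
        le_trans[of "(m \<sqinter> n) \<sqinter> x" "n \<sqinter> x" z] by (simp add: le_meet_iff)
    ultimately show "y \<sqinter> z \<in> G" using mn by (auto simp: G_def)
  next
    fix y z assume "y \<in> G" "z \<in> carrier L" "y \<sqsubseteq> z"
    then obtain m where "m \<in> F" "m \<sqinter> x \<sqsubseteq> y" "y \<in> carrier L" by (auto simp: G_def)
    then have "m \<sqinter> x \<sqsubseteq> z"
      using \<open>y \<sqsubseteq> z\<close> \<open>z \<in> carrier L\<close> Fc x le_trans[of "m \<sqinter> x" y z] by simp
    then show "z \<in> G" using \<open>m \<in> F\<close> \<open>z \<in> carrier L\<close> by (auto simp: G_def)
  qed
qed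

text \<open>
  A filter that is maximal among those containing \<open>a\<close> and missing \<open>S\<close> is prime: if neither \<open>x\<close>
  nor \<open>y\<close> belongs to it, adjoining either one hits \<open>S\<close>, say in \<open>s\<close> and in \<open>t\<close>, and by
  distributivity \<open>x \<squnion> y\<close> would put \<open>s \<squnion> t\<close> into the filter. Separating from a set closed under
  joins instead of a single element is what makes the Stone topology compact.
\<close>
lemma prime_filter_separation:
  assumes a: "a \<in> carrier L" and S: "S \<subseteq> carrier L" "S \<noteq> {}"
    and directed: "\<And>s t. \<lbrakk>s \<in> S; t \<in> S\<rbrakk> \<Longrightarrow> s \<squnion> t \<in> S"
    and above: "\<And>s. s \<in> S \<Longrightarrow> \<not> a \<sqsubseteq> s"
  obtains F where "F \<in> prime_filters" "a \<in> F" "F \<inter> S = {}"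
proof -
  let ?\<F> = "{F. lattice_filter F \<and> a \<in> F \<and> F \<inter> S = {}}"
  have "{x \<in> carrier L. a \<sqsubseteq> x} \<in> ?\<F>"
    using a S above le_trans[OF _ _ a] by (auto simp: lattice_filter_def le_meet_iff)
  then have ne: "?\<F> \<noteq> {}" by blast
  have "\<Union>\<C> \<in> ?\<F>" if ne: "\<C> \<noteq> {}" and ch: "subset.chain ?\<F> \<C>" for \<C>
  proof -
    have sub: "\<And>F. F \<in> \<C> \<Longrightarrow> lattice_filter F \<and> a \<in> F \<and> F \<inter> S = {}"
      and cmp: "\<And>F G. F \<in> \<C> \<Longrightarrow> G \<in> \<C> \<Longrightarrow> F \<subseteq> G \<or> G \<subseteq> F"
      using ch by (auto simp: subset_chain_def)
    have "x \<sqinter> y \<in> \<Union>\<C>" if xy: "x \<in> \<Union>\<C>" "y \<in> \<Union>\<C>" for x y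
    proof -
      obtain F G where "F \<in> \<C>" "G \<in> \<C>" "x \<in> F" "y \<in> G" using xy by blast
      then obtain H where "H \<in> \<C>" "x \<in> H" "y \<in> H" using cmp by blast
      then show ?thesis using sub[of H] by (auto simp: lattice_filter_def)
    qed
    note meet = this
    obtain F where F: "F \<in> \<C>" using ne by blast
    show ?thesis
      unfolding lattice_filter_def
    proof (intro CollectI conjI ballI impI)
      show "\<Union>\<C> \<subseteq> carrier L"
        by (rule Union_least) (use sub in \<open>simp add: lattice_filter_def\<close>)
      show "\<top> \<in> \<Union>\<C>" "a \<in> \<Union>\<C>"
        by (rule UnionI[OF F], use sub[OF F] in \<open>simp add: lattice_filter_def\<close>)+
      show "\<Union>\<C> \<inter> S = {}" using sub by blast
      fix x assume x: "x \<in> \<Union>\<C>"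
      show "x \<sqinter> y \<in> \<Union>\<C>" if "y \<in> \<Union>\<C>" for y by (rule meet[OF x that])
      show "y \<in> \<Union>\<C>" if y: "y \<in> carrier L" "x \<sqsubseteq> y" for y
      proof -
        obtain G where G: "G \<in> \<C>" "x \<in> G" using x by blast
        then have "y \<in> G" using y sub[OF G(1)] by (simp add: lattice_filter_def)
        with G show ?thesis by blast
      qed
    qed
  qed
  from subset_Zorn_nonempty[OF ne this]
  obtain M where "M \<in> ?\<F>" and maximal: "\<forall>G\<in>?\<F>. M \<subseteq> G \<longrightarrow> G = M"
    by (rule bexE)
  then have M: "lattice_filter M" "a \<in> M" "M \<inter> S = {}" by simp_all
  have max: "G = M" if "lattice_filter G" "M \<subseteq> G" "G \<inter> S = {}" for G
    using maximal[rule_format, of G] that M(2) by blast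
  have Mc: "m \<in> carrier L" if "m \<in> M" for m using M that by (auto simp: lattice_filter_def)
  have Mup: "y \<in> M" if "x \<in> M" "x \<sqsubseteq> y" "y \<in> carrier L" for x y
    using M that by (auto simp: lattice_filter_def)
  have hits: "\<exists>m\<in>M. \<exists>s\<in>S. m \<sqinter> x \<sqsubseteq> s" if x: "x \<in> carrier L" "x \<notin> M" for x
  proof (rule ccontr)
    assume "\<not> ?thesis"
    then have "{z \<in> carrier L. \<exists>m\<in>M. m \<sqinter> x \<sqsubseteq> z} = M"
      by (intro max filter_adjoin[OF M(1) x(1)]) auto
    then show False using filter_adjoin(3)[OF M(1) x(1)] x by auto
  qed
  have prime: "x \<in> M \<or> y \<in> M" if xy: "x \<in> carrier L" "y \<in> carrier L" "x \<squnion> y \<in> M" for x y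
  proof (rule ccontr)
    assume "\<not> ?thesis"
    then obtain m n s t where mn: "m \<in> M" "n \<in> M" "s \<in> S" "t \<in> S" "m \<sqinter> x \<sqsubseteq> s" "n \<sqinter> y \<sqsubseteq> t"
      using hits xy by meson
    have car: "m \<in> carrier L" "n \<in> carrier L" "s \<in> carrier L" "t \<in> carrier L"
      using mn Mc S by auto
    have k: "m \<sqinter> n \<in> M" using M mn by (auto simp: lattice_filter_def)
    have "(m \<sqinter> n) \<sqinter> x \<sqsubseteq> m \<sqinter> x" "(m \<sqinter> n) \<sqinter> y \<sqsubseteq> n \<sqinter> y"
      using car xy by (simp_all add: meet_mono meet_left meet_right)
    then have "(m \<sqinter> n) \<sqinter> x \<sqsubseteq> s" "(m \<sqinter> n) \<sqinter> y \<sqsubseteq> t"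
      using car xy mn le_trans[of "(m \<sqinter> n) \<sqinter> x" "m \<sqinter> x" s]
        le_trans[of "(m \<sqinter> n) \<sqinter> y" "n \<sqinter> y" t] by simp_all
    then have "(m \<sqinter> n) \<sqinter> x \<sqsubseteq> s \<squnion> t" "(m \<sqinter> n) \<sqinter> y \<sqsubseteq> s \<squnion> t"
      using car xy le_trans[of "(m \<sqinter> n) \<sqinter> x" s "s \<squnion> t"]
        le_trans[of "(m \<sqinter> n) \<sqinter> y" t "s \<squnion> t"] by (simp_all add: join_left join_right)
    then have "(m \<sqinter> n) \<sqinter> (x \<squnion> y) \<sqsubseteq> s \<squnion> t"
      using car xy by (simp add: meet_join_distrib join_le)
    moreover have "(m \<sqinter> n) \<sqinter> (x \<squnion> y) \<in> M" using k xy M by (auto simp: lattice_filter_def)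
    ultimately have "s \<squnion> t \<in> M" using Mup car by simp
    then show False using directed mn M by blast
  qed
  have "\<bottom> \<notin> M"
    using Mup[of \<bottom>] S M by auto
  then have "M \<in> prime_filters" using M prime by (auto simp: prime_filters_def)
  then show thesis using that M by blast
qed

definition stone :: "'a \<Rightarrow> 'a set set" where
  "stone a = {F \<in> prime_filters. a \<in> F}"

lemma stone_subset: "stone a \<subseteq> prime_filters"
  by (auto simp: stone_def)

text \<open>
  Compactness of \<open>stone a\<close>, stated for covers indexed by a set closed under joins, where a finite
  subcover amounts to a single member.
\<close>
lemma stone_compact:
  assumes "a \<in> carrier L" "S \<subseteq> carrier L" "S \<noteq> {}"
    and "\<And>s t. \<lbrakk>s \<in> S; t \<in> S\<rbrakk> \<Longrightarrow> s \<squnion> t \<in> S"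
    and cover: "stone a \<subseteq> (\<Union>s\<in>S. stone s)"
  obtains s where "s \<in> S" "a \<sqsubseteq> s"
proof (rule ccontr)
  assume "\<not> thesis"
  with that have "\<And>s. s \<in> S \<Longrightarrow> \<not> a \<sqsubseteq> s" by blast
  from prime_filter_separation[OF assms(1-4) this]
  obtain F where "F \<in> prime_filters" "a \<in> F" "F \<inter> S = {}" by blast
  with cover show False by (auto simp: stone_def)
qed

lemma stone_mono: "\<lbrakk>a \<in> carrier L; b \<in> carrier L; a \<sqsubseteq> b\<rbrakk> \<Longrightarrow> stone a \<subseteq> stone b"
  by (auto simp: stone_def prime_filters_def lattice_filter_def)

lemma stone_le_iff:
  assumes "a \<in> carrier L" "b \<in> carrier L"
  shows "stone a \<subseteq> stone b \<longleftrightarrow> a \<sqsubseteq> b"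
proof
  assume "stone a \<subseteq> stone b"
  moreover have "b \<squnion> b = b" using assms le_iff_meet[of b b] by simp
  ultimately show "a \<sqsubseteq> b"
    using stone_compact[of a "{b}"] assms by auto
qed (use assms stone_mono in blast)

lemma stone_top: "stone \<top> = prime_filters"
  by (auto simp: stone_def prime_filters_def lattice_filter_def)

lemma stone_bottom: "stone \<bottom> = {}"
  by (auto simp: stone_def prime_filters_def lattice_filter_def)

lemma stone_meet:
  assumes "a \<in> carrier L" "b \<in> carrier L"
  shows "stone (a \<sqinter> b) = stone a \<inter> stone b"
proof
  show "stone (a \<sqinter> b) \<subseteq> stone a \<inter> stone b"
    using assms stone_mono[of "a \<sqinter> b"] by (auto simp: meet_left meet_right)
  show "stone a \<inter> stone b \<subseteq> stone (a \<sqinter> b)"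
    by (auto simp: stone_def prime_filters_def lattice_filter_def)
qed

lemma stone_join:
  assumes "a \<in> carrier L" "b \<in> carrier L"
  shows "stone (a \<squnion> b) = stone a \<union> stone b"
proof
  show "stone a \<union> stone b \<subseteq> stone (a \<squnion> b)"
    using assms stone_mono[of _ "a \<squnion> b"] by (auto simp: join_left join_right)
  show "stone (a \<squnion> b) \<subseteq> stone a \<union> stone b"
    using assms by (auto simp: stone_def prime_filters_def)
qed

lemma stone_compl:
  assumes "a \<in> carrier L"
  shows "stone (compl L a) = prime_filters - stone a"
  using stone_meet[OF assms compl_closed[OF assms]] stone_join[OF assms compl_closed[OF assms]]
  by (auto simp: meet_compl join_compl assms stone_top stone_bottom)

end

section \<open>Interior operators on the prime filters\<close>

context interior_algebra
begin

text \<open>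
  The interior of \<open>U\<close> in the topology with basis \<open>{stone (f b) | b}\<close>. It suffices to use the
  \<open>b\<close> with \<open>stone b \<subseteq> U\<close>, since \<open>f b = f (f b)\<close>.
\<close>
definition stone_int :: "'a set set \<Rightarrow> 'a set set" where
  "stone_int U = \<Union>{stone (f b) |b. b \<in> carrier L \<and> stone b \<subseteq> U}"

lemma stone_intI:
  "\<lbrakk>b \<in> carrier L; stone b \<subseteq> U; u \<in> stone (f b)\<rbrakk> \<Longrightarrow> u \<in> stone_int U"
  unfolding stone_int_def by blast

lemma stone_intE:
  assumes "u \<in> stone_int U"
  obtains b where "b \<in> carrier L" "stone b \<subseteq> U" "u \<in> stone (f b)"
  using assms unfolding stone_int_def by blast

lemma stone_int_stone:
  assumes a: "a \<in> carrier L"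
  shows "stone_int (stone a) = stone (f a)"
proof
  show "stone_int (stone a) \<subseteq> stone (f a)"
  proof
    fix u assume "u \<in> stone_int (stone a)"
    then obtain b where b: "b \<in> carrier L" "stone b \<subseteq> stone a" "u \<in> stone (f b)"
      by (rule stone_intE)
    then have "f b \<sqsubseteq> f a" using a by (simp add: stone_le_iff int_mono)
    then show "u \<in> stone (f a)"
      using stone_mono[OF int_closed[OF b(1)] int_closed[OF a]] b(3) by blast
  qed
  show "stone (f a) \<subseteq> stone_int (stone a)"
    by (rule subsetI) (rule stone_intI[OF a subset_refl])
qed

lemma stone_int_subset: "stone_int U \<subseteq> U"
proof
  fix u assume "u \<in> stone_int U"
  then obtain b where b: "b \<in> carrier L" "stone b \<subseteq> U" "u \<in> stone (f b)"
    by (rule stone_intE)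
  with stone_mono[OF int_closed[OF b(1)] b(1) int_le[OF b(1)]] show "u \<in> U" by blast
qed

lemma stone_int_mono: "U \<subseteq> V \<Longrightarrow> stone_int U \<subseteq> stone_int V"
  unfolding stone_int_def by (rule Union_mono) blast

lemma stone_int_space: "stone_int prime_filters = prime_filters"
  using stone_int_stone[OF top_closed] by (simp add: stone_top int_top)

lemma stone_int_Int: "stone_int (U \<inter> V) = stone_int U \<inter> stone_int V"
proof
  show "stone_int (U \<inter> V) \<subseteq> stone_int U \<inter> stone_int V"
    by (simp add: stone_int_mono)
  show "stone_int U \<inter> stone_int V \<subseteq> stone_int (U \<inter> V)"
  proof
    fix u assume "u \<in> stone_int U \<inter> stone_int V"
    then have u: "u \<in> stone_int U" "u \<in> stone_int V" by simp_all
    obtain b where b: "b \<in> carrier L" "stone b \<subseteq> U" "u \<in> stone (f b)"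
      using u(1) by (rule stone_intE)
    obtain c where c: "c \<in> carrier L" "stone c \<subseteq> V" "u \<in> stone (f c)"
      using u(2) by (rule stone_intE)
    have "u \<in> stone (f (b \<sqinter> c))" "stone (b \<sqinter> c) \<subseteq> U \<inter> V"
      using b c by (simp_all add: int_meet stone_meet int_closed le_infI1 le_infI2)
    then show "u \<in> stone_int (U \<inter> V)"
      using b(1) c(1) by (intro stone_intI[of "b \<sqinter> c"]) simp_all
  qed
qed

lemma stone_int_idem: "stone_int (stone_int U) = stone_int U"
proof
  show "stone_int U \<subseteq> stone_int (stone_int U)"
  proof
    fix u assume "u \<in> stone_int U"
    then obtain b where b: "b \<in> carrier L" "stone b \<subseteq> U" "u \<in> stone (f b)"
      by (rule stone_intE)
    have "stone (f b) \<subseteq> stone_int U"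
      by (rule subsetI) (rule stone_intI[OF b(1,2)])
    moreover have "u \<in> stone (f (f b))"
      using b(3) int_idem[OF b(1)] by simp
    ultimately show "u \<in> stone_int (stone_int U)"
      by (rule stone_intI[OF int_closed[OF b(1)]])
  qed
qed (rule stone_int_subset)

text \<open>
  The interior of \<open>U\<close> is an infinite union, but a compact set \<open>stone a\<close> inside it is already inside
  one of its pieces: the pieces are directed because \<open>f b \<squnion> f c \<le> f (b \<squnion> c)\<close>. This step leads
  from sets of prime filters back to elements of the algebra.
\<close>
lemma stone_subset_stone_intE:
  assumes a: "a \<in> carrier L" and sub: "stone a \<subseteq> stone_int U"
  obtains b where "b \<in> carrier L" "stone b \<subseteq> U" "a \<sqsubseteq> f b"
proof -
  \<comment> \<open>The elements \<open>f b\<close> themselves need not be closed under joins; their down-closure is.\<close>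
  let ?S = "{c \<in> carrier L. \<exists>b\<in>carrier L. stone b \<subseteq> U \<and> c \<sqsubseteq> f b}"
  have "f \<bottom> \<in> ?S"
    using int_closed[OF bottom_closed] bottom_closed by (auto simp: stone_bottom intro!: bexI[of _ \<bottom>])
  then have ne: "?S \<noteq> {}" by blast
  have dir: "s \<squnion> t \<in> ?S" if S: "s \<in> ?S" "t \<in> ?S" for s t
  proof -
    obtain b c where bc: "b \<in> carrier L" "c \<in> carrier L" "stone b \<subseteq> U" "stone c \<subseteq> U"
      "s \<sqsubseteq> f b" "t \<sqsubseteq> f c" using S by auto
    have st: "s \<in> carrier L" "t \<in> carrier L" using S by auto
    have "f b \<sqsubseteq> f (b \<squnion> c)" "f c \<sqsubseteq> f (b \<squnion> c)"
      using bc by (simp_all add: int_mono join_left join_right)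
    then have "s \<sqsubseteq> f (b \<squnion> c)" "t \<sqsubseteq> f (b \<squnion> c)"
      using bc st le_trans[of s "f b" "f (b \<squnion> c)"] le_trans[of t "f c" "f (b \<squnion> c)"]
      by (simp_all add: int_closed)
    then have "s \<squnion> t \<sqsubseteq> f (b \<squnion> c)"
      using bc st by (simp add: int_closed join_le)
    moreover have "stone (b \<squnion> c) \<subseteq> U" using bc by (simp add: stone_join)
    ultimately show ?thesis using bc st by auto
  qed
  have cover: "stone a \<subseteq> (\<Union>s\<in>?S. stone s)"
  proof
    fix u assume "u \<in> stone a"
    with sub have "u \<in> stone_int U" by (rule subsetD)
    then obtain b where b: "b \<in> carrier L" "stone b \<subseteq> U" "u \<in> stone (f b)"
      by (rule stone_intE)
    then have "f b \<in> ?S" using int_closed[OF b(1)] by auto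
    then show "u \<in> (\<Union>s\<in>?S. stone s)" using b(3) by (rule UN_I)
  qed
  obtain s where s: "s \<in> ?S" "a \<sqsubseteq> s"
    by (rule stone_compact[OF a _ ne dir cover]) (auto intro: that)
  then obtain b where b: "b \<in> carrier L" "stone b \<subseteq> U" "s \<sqsubseteq> f b" by blast
  have "a \<sqsubseteq> f b"
    using s b(3) le_trans[of a s "f b"] a int_closed[OF b(1)] by simp
  then show thesis by (rule that[OF b(1,2)])
qed

end

section \<open>The embedding of a standard algebra\<close>

text \<open>
  One element \<open>b\<close> serves all indices at once: the join of the witnesses for the single indices.
  This uses that the index set is finite.
\<close>
lemma stone_subset_common_box:
  assumes A: "S4C_algebra I A" and "finite J" "J \<subseteq> I"
    and a: "a \<in> carrier A"
    and Y: "\<And>i. i \<in> J \<Longrightarrow> boolean_lattice.stone A a \<subseteq> interior_algebra.stone_int A (box A i) Y"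
  shows "\<exists>b\<in>carrier A. boolean_lattice.stone A b \<subseteq> Y \<and> (\<forall>i\<in>J. a \<sqsubseteq>\<^bsub>A\<^esub> box A i b)"
  using assms(2,3) Y
proof (induction J rule: finite_induct)
  case empty
  interpret boolean_lattice A using A by (simp add: S4C_algebra_def)
  show ?case using bottom_closed stone_bottom by blast
next
  case (insert k J)
  interpret interior_algebra A "box A k"
    using A insert.prems by (simp add: S4C_algebra_def)
  obtain b where b: "b \<in> carrier A" "stone b \<subseteq> Y" "\<forall>i\<in>J. a \<sqsubseteq>\<^bsub>A\<^esub> box A i b"
    using insert by auto
  have "stone a \<subseteq> stone_int Y" by (rule insert.prems(2)) simp
  from stone_subset_stone_intE[OF a this]
  obtain c where c: "c \<in> carrier A" "stone c \<subseteq> Y" "a \<sqsubseteq>\<^bsub>A\<^esub> box A k c" .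
  have bc: "b \<squnion>\<^bsub>A\<^esub> c \<in> carrier A" using b c by simp
  have "a \<sqsubseteq>\<^bsub>A\<^esub> box A i (b \<squnion>\<^bsub>A\<^esub> c)" if i: "i \<in> insert k J" for i
  proof -
    have "i \<in> I" using i insert.prems(1) by blast
    then interpret i: interior_algebra A "box A i" using A by (simp add: S4C_algebra_def)
    obtain x where x: "x \<in> carrier A" "a \<sqsubseteq>\<^bsub>A\<^esub> box A i x" "x \<sqsubseteq>\<^bsub>A\<^esub> b \<squnion>\<^bsub>A\<^esub> c"
      using i b c join_left[OF b(1) c(1)] join_right[OF b(1) c(1)] by blast
    show ?thesis
      by (rule le_trans[OF x(2) i.int_mono[OF x(1) bc x(3)] a
            i.int_closed[OF x(1)] i.int_closed[OF bc]])
  qed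
  moreover have "stone (b \<squnion>\<^bsub>A\<^esub> c) \<subseteq> Y" using b c by (simp add: stone_join)
  ultimately show ?case using bc by blast
qed

text \<open>
  The post-fixpoints \<open>Y\<close> are arbitrary sets of prime filters, whereas standardness speaks about
  sequences of elements. Iterating the previous lemma from a basic neighbourhood of a given point
  of \<open>Y\<close> yields such a sequence inside \<open>Y\<close>.
\<close>
lemma standard_postfixpoint_subset:
  fixes A :: "('a, 'i) ck_structure"
  assumes I: "finite I" "I \<noteq> {}" and A: "S4C_algebra I A" and std: "standard I A"
    and d: "d \<in> carrier A"
    and Yd: "\<And>i. i \<in> I \<Longrightarrow>
      Y \<subseteq> interior_algebra.stone_int A (box A i) (boolean_lattice.stone A d)"
    and YY: "\<And>i. i \<in> I \<Longrightarrow> Y \<subseteq> interior_algebra.stone_int A (box A i) Y"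
  shows "Y \<subseteq> boolean_lattice.stone A (com A d)"
proof
  interpret boolean_lattice A using A by (simp add: S4C_algebra_def)
  fix u assume u: "u \<in> Y"
  \<comment> \<open>Any index provides a starting element: \<open>Y\<close> is open for each of the topologies.\<close>
  obtain i where i: "i \<in> I" using I(2) by blast
  then interpret i: interior_algebra A "box A i" using A by (simp add: S4C_algebra_def)
  have "u \<in> i.stone_int Y" using YY[OF i] u by (rule subsetD)
  then obtain b where b: "b \<in> carrier A" "stone b \<subseteq> Y" "u \<in> stone (box A i b)"
    by (rule i.stone_intE)
  have ub: "u \<in> stone b"
    using stone_mono[OF i.int_closed[OF b(1)] b(1) i.int_le[OF b(1)]] b(3) by (rule subsetD)
  have step: "\<exists>y. (y \<in> carrier A \<and> stone y \<subseteq> Y) \<and> (\<forall>i\<in>I. x \<sqsubseteq>\<^bsub>A\<^esub> box A i y)"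
    if x: "x \<in> carrier A" "stone x \<subseteq> Y" for x
    using stone_subset_common_box[OF A I(1) subset_refl x(1) subset_trans[OF x(2) YY]] by blast
  have "\<exists>a. \<forall>n. ((a n \<in> carrier A \<and> stone (a n) \<subseteq> Y) \<and> (n = 0 \<longrightarrow> a n = b)) \<and>
      (\<forall>i\<in>I. a n \<sqsubseteq>\<^bsub>A\<^esub> box A i (a (Suc n)))"
  proof (rule dependent_nat_choice)
    show "\<exists>x. (x \<in> carrier A \<and> stone x \<subseteq> Y) \<and> (0 = (0::nat) \<longrightarrow> x = b)"
      using b by blast
    show "\<exists>y. ((y \<in> carrier A \<and> stone y \<subseteq> Y) \<and> (Suc n = 0 \<longrightarrow> y = b)) \<and>
        (\<forall>i\<in>I. x \<sqsubseteq>\<^bsub>A\<^esub> box A i y)"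
      if "(x \<in> carrier A \<and> stone x \<subseteq> Y) \<and> (n = 0 \<longrightarrow> x = b)" for x and n :: nat
      using step[of x] that by simp
  qed
  then obtain a where a: "\<forall>n. ((a n \<in> carrier A \<and> stone (a n) \<subseteq> Y) \<and> (n = 0 \<longrightarrow> a n = b)) \<and>
      (\<forall>i\<in>I. a n \<sqsubseteq>\<^bsub>A\<^esub> box A i (a (Suc n)))" ..
  then have ac: "a n \<in> carrier A" and aY: "stone (a n) \<subseteq> Y" and a0: "a 0 = b"
    and a_step: "i \<in> I \<Longrightarrow> a n \<sqsubseteq>\<^bsub>A\<^esub> box A i (a (Suc n))" for n i
    by simp_all
  \<comment> \<open>Every member of the sequence lies below \<open>\<box>\<^sub>i d\<close>, since its Stone set lies in \<open>Y\<close>.\<close>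
  have a_d: "a n \<sqsubseteq>\<^bsub>A\<^esub> box A k d" if k: "k \<in> I" for n k
  proof -
    interpret k: interior_algebra A "box A k" using A k by (simp add: S4C_algebra_def)
    have "stone (a n) \<subseteq> stone (box A k d)"
      using subset_trans[OF aY Yd[OF k]] by (simp only: k.stone_int_stone[OF d])
    then show ?thesis using stone_le_iff[OF ac k.int_closed[OF d]] by simp
  qed
  have "a n \<sqsubseteq>\<^bsub>A\<^esub> everyone I A d \<sqinter>\<^bsub>A\<^esub> everyone I A (a (n + 1))" for n
    using a_step a_d by (simp add: S4C_le_everyone_meet_iff[OF A I ac d ac])
  with std d ac have "a 0 \<sqsubseteq>\<^bsub>A\<^esub> com A d"
    unfolding standard_def by simp
  moreover have "com A d \<in> carrier A"
    using A d by (simp add: S4C_algebra_def interior_algebra.int_closed)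
  ultimately have "stone b \<subseteq> stone (com A d)"
    using stone_mono[OF b(1)] a0 by simp
  then show "u \<in> stone (com A d)" using ub by (rule subsetD)
qed

lemma standard_imp_embeddable:
  fixes A :: "('a, 'i) ck_structure"
  assumes I: "finite I" "I \<noteq> {}" and A: "S4C_algebra I A" and std: "standard I A"
  shows "embeddable_into_complete TYPE('a set set) I A"
proof -
  interpret boolean_lattice A using A by (simp add: S4C_algebra_def)
  have alg: "interior_algebra A (box A i)" if "i \<in> I" for i
    using A that by (simp add: S4C_algebra_def)
  define bx where "bx i = interior_algebra.stone_int A (box A i)" for i
  interpret B: interior_frame prime_filters I bx
    by unfold_locales
      (simp_all add: I bx_def interior_algebra.stone_int_space[OF alg]
        interior_algebra.stone_int_Int[OF alg] interior_algebra.stone_int_idem[OF alg]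
        interior_algebra.stone_int_subset[OF alg])
  have bx_stone: "bx i (stone a) = stone (box A i a)" if "i \<in> I" "a \<in> carrier A" for i a
    unfolding bx_def by (rule interior_algebra.stone_int_stone[OF alg[OF that(1)] that(2)])
  have com_stone: "B.common (stone d) = stone (com A d)" if d: "d \<in> carrier A" for d
  proof
    have c: "com A d \<in> carrier A"
      using A d by (simp add: S4C_algebra_def interior_algebra.int_closed)
    have "com A d \<sqsubseteq>\<^bsub>A\<^esub> everyone I A d \<sqinter>\<^bsub>A\<^esub> everyone I A (com A d)"
      using A d by (simp add: S4C_algebra_def)
    then have le: "\<forall>i\<in>I. com A d \<sqsubseteq>\<^bsub>A\<^esub> box A i d \<and> com A d \<sqsubseteq>\<^bsub>A\<^esub> box A i (com A d)"
      by (simp add: S4C_le_everyone_meet_iff[OF A I c d c])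
    show "stone (com A d) \<subseteq> B.common (stone d)"
      by (rule B.common_greatest)
        (use le c d in \<open>simp_all add: stone_subset bx_stone stone_le_iff S4C_box_closed[OF A]\<close>)
    show "B.common (stone d) \<subseteq> stone (com A d)"
    proof (rule standard_postfixpoint_subset[OF I A std d])
      fix i assume i: "i \<in> I"
      show "B.common (stone d) \<subseteq> interior_algebra.stone_int A (box A i) (stone d)"
        using B.common_le_int[OF i] by (simp only: bx_def)
      show "B.common (stone d) \<subseteq> interior_algebra.stone_int A (box A i) (B.common (stone d))"
        using B.common_le_int_common[OF i] by (simp only: bx_def)
    qed
  qed
  have "inj_on stone (carrier A)"
  proof (rule inj_onI)
    fix x y assume xy: "x \<in> carrier A" "y \<in> carrier A" and "stone x = stone y"
    then have "x \<sqsubseteq>\<^bsub>A\<^esub> y" "y \<sqsubseteq>\<^bsub>A\<^esub> x" by (simp_all flip: stone_le_iff)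
    then show "x = y" using xy by (rule le_antisym)
  qed
  then have "embedding I A B.P stone"
    by (simp add: embedding_def stone_subset stone_top stone_bottom stone_meet stone_join
        stone_compl B.P_compl bx_stone com_stone)
  then show ?thesis
    unfolding embeddable_into_complete_def
    using B.powerset_algebra_S4C B.powerset_algebra_complete by blast
qed

theorem corollary1:
  fixes I :: "'i set" and A :: "('a, 'i) ck_structure"
  assumes "finite I" and "I \<noteq> {}" and "S4C_algebra I A"
  shows "(embeddable_into_complete TYPE('a set set) I A \<longleftrightarrow> standard I A) \<and>
         (embeddable_into_complete TYPE('b) I A \<longrightarrow> standard I A)"
proof (intro conjI iffI impI)
  show "embeddable_into_complete TYPE('a set set) I A" if "standard I A"
    by (rule standard_imp_embeddable[OF assms that])
qed (rule embeddable_into_complete_imp_standard[OF assms(3,1,2)], assumption)+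

end
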